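(* Let $a$ and $d$ be positive integers with $a\ge 2$ and $\gcd(a,d)=1$, let $K$ and $k$ be positive integers with $(k-1)/2<K\le (2k-2)/3$, let $r=a+K-\lfloor (a+K)/k\rfloor k$, and assume $\lfloor (a+K)/k\rfloor\ge 2$. Then $$ g\bigl(a,a+(K+1)d,a+(K+2)d,\dots,a+k d\bigr)=\begin{cases}\dfrac{a(a+K-r)}{k}+(a+2 K+1)d&\text{if } 0\le r\le k-K-1,\\[1ex] \dfrac{a(a+K-r+k)}{k}+(a+2 K+1)d&\text{if } k-K\le r<k.\end{cases} $$
   Context: For positive integers $a_1,\dots,a_m$ with $\gcd(a_1,\dots,a_m)=1$, the Frobenius number $g(a_1,\dots,a_m)$ is the largest positive integer that cannot be written as $x_1a_1+\cdots+x_ma_m$ with nonnegative integers $x_i$. $\lfloor x\rfloor$ denotes the floor. *)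

theory Defs
  imports Complex_Main
begin

definition representable :: "nat list \<Rightarrow> nat \<Rightarrow> bool" where
  "representable A n \<longleftrightarrow> (\<exists>x :: nat \<Rightarrow> nat. n = (\<Sum>i<length A. x i * A ! i))"

(* Meaningful when the generators are positive with gcd 1 and 1 is not among them, as then
   a largest non-representable positive integer exists; otherwise the value is unspecified. *)
definition frobenius_number :: "nat list \<Rightarrow> nat" where
  "frobenius_number A = (GREATEST n. n > 0 \<and> \<not> representable A n)"

end

theory Submission
  imports Defs "HOL-Number_Theory.Cong"
begin

text \<open>A combination of the generators is \<open>m * a + D * d\<close>, where \<open>D\<close> is a sum of \<open>s \<le> m\<close> numbers from
  \<open>{K + 1..k}\<close>, i.e. \<open>s * (K + 1) \<le> D \<le> s * k\<close>. Since \<open>k \<le> 2 * K\<close> and \<open>3 * K + 2 \<le> 2 * k\<close>, every \<open>D\<close>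
  outside the two gaps \<open>{1..K}\<close> and \<open>{k + 1..2 * K + 1}\<close> is such a sum, with \<open>\<lceil>D / k\<rceil>\<close> as the least possible
  number of summands. Residues modulo \<open>a\<close> are represented by \<open>D < a\<close>, except that an element of a gap has to be
  replaced by \<open>D + a\<close>. The worst residue is that of the last gap element \<open>2 * K + 1\<close>, and
  \<open>\<lceil>(a + 2 * K + 1) / k\<rceil> - 1 = (a + 2 * K) div k\<close>.\<close>

text \<open>Greedy choice: taking \<open>min e w\<close> as one of the \<open>s\<close> summands
  leaves either 0 or \<open>e - w\<close> for the others. Here \<open>y i\<close> is the
  multiplicity of the summand \<open>i\<close>.\<close>

lemma ex_multiplicities_sum:
  fixes s e w :: nat
  assumes "e \<le> s * w"
  shows "\<exists>y. (\<Sum>i\<le>w. y i) = s \<and> (\<Sum>i\<le>w. y i * i) = e"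
  using assms
proof (induction s arbitrary: e)
  case 0
  then show ?case by (intro exI[of _ "\<lambda>_. 0"]) simp
next
  case (Suc s)
  define j where "j = min e w"
  have "e - j \<le> s * w" using Suc.prems by (auto simp: j_def min_def)
  from Suc.IH[OF this] obtain y where y: "(\<Sum>i\<le>w. y i) = s" "(\<Sum>i\<le>w. y i * i) = e - j"
    by blast
  have "j \<le> w" "j \<le> e" by (auto simp: j_def)
  let ?y = "\<lambda>i. y i + (if i = j then 1 else 0)"
  have "(\<Sum>i\<le>w. ?y i) = Suc s"
    using y \<open>j \<le> w\<close> by (simp add: sum.distrib)
  moreover have "(\<Sum>i\<le>w. ?y i * i) = (\<Sum>i\<le>w. y i * i) + (\<Sum>i\<le>w. if i = j then i else 0)"
    unfolding sum.distrib[symmetric] by (intro sum.cong) auto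
  then have "(\<Sum>i\<le>w. ?y i * i) = e"
    using y \<open>j \<le> w\<close> \<open>j \<le> e\<close> by simp
  ultimately show ?case by blast
qed

text \<open>\<open>m\<close> counts all generators used and \<open>s\<close> those other than
  \<open>a\<close>. Conversely, giving each of the \<open>s\<close> summands its minimum
  \<open>K + 1\<close> leaves an excess of at most \<open>s * (k - K - 1)\<close>, which
  \<open>ex_multiplicities_sum\<close> distributes.\<close>

lemma representable_arith_iff:
  fixes a d K k n :: nat
  assumes "K < k"
  shows "representable (a # map (\<lambda>i. a + i * d) [K + 1..<k + 1]) n \<longleftrightarrow>
    (\<exists>m s D. s \<le> m \<and> s * (K + 1) \<le> D \<and> D \<le> s * k \<and> n = m * a + D * d)"
    (is "representable ?A n \<longleftrightarrow> ?R")
proof -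
  have len: "length ?A = Suc (k - K)" using assms by (simp add: Suc_diff_Suc)
  have expand: "(\<Sum>i<length ?A. x i * ?A ! i) =
      (x 0 + (\<Sum>i<k - K. x (Suc i))) * a + (\<Sum>i<k - K. x (Suc i) * (K + 1 + i)) * d" for x :: "nat \<Rightarrow> nat"
  proof -
    have "(\<Sum>i<length ?A. x i * ?A ! i) = x 0 * a + (\<Sum>i<k - K. x (Suc i) * (?A ! Suc i))"
      unfolding len sum.lessThan_Suc_shift by simp
    also have "(\<Sum>i<k - K. x (Suc i) * (?A ! Suc i)) =
        (\<Sum>i<k - K. x (Suc i) * a + x (Suc i) * (K + 1 + i) * d)"
      by (intro sum.cong) (auto simp: algebra_simps nth_append simp del: upt_Suc)
    also have "\<dots> = (\<Sum>i<k - K. x (Suc i)) * a + (\<Sum>i<k - K. x (Suc i) * (K + 1 + i)) * d"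
      by (simp only: sum.distrib sum_distrib_right)
    finally show ?thesis by (simp add: algebra_simps)
  qed
  show ?thesis
  proof
    assume "representable ?A n"
    then obtain x where x: "n = (\<Sum>i<length ?A. x i * ?A ! i)"
      unfolding representable_def by blast
    let ?s = "\<Sum>i<k - K. x (Suc i)" and ?D = "\<Sum>i<k - K. x (Suc i) * (K + 1 + i)"
    have "?s * (K + 1) \<le> ?D"
      unfolding sum_distrib_right by (intro sum_mono) simp
    moreover have "?D \<le> ?s * k"
      unfolding sum_distrib_right by (intro sum_mono mult_left_mono) auto
    ultimately show ?R
      using x unfolding expand
      by (intro exI[of _ "x 0 + ?s"] exI[of _ ?s] exI[of _ ?D] conjI) (simp_all only: le_add2)
  next
    assume ?R
    then obtain m s D where *: "s \<le> m" "s * (K + 1) \<le> D" "D \<le> s * k" "n = m * a + D * d"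
      by blast
    define w where "w = k - K - 1"
    have "k = K + 1 + w" using assms by (simp add: w_def)
    then have "D - s * (K + 1) \<le> s * w" using *(3) by (simp add: algebra_simps)
    from ex_multiplicities_sum[OF this] obtain y
      where y: "(\<Sum>i\<le>w. y i) = s" "(\<Sum>i\<le>w. y i * i) = D - s * (K + 1)" by blast
    have w: "{..<k - K} = {..w}" using assms by (auto simp: w_def)
    \<comment> \<open>Index 0 is the generator \<open>a\<close> itself; it fills the count up from
      \<open>s\<close> to \<open>m\<close>.\<close>
    define x where "x i = (case i of 0 \<Rightarrow> m - s | Suc i \<Rightarrow> y i)" for i
    have "(\<Sum>i\<le>w. y i * (K + 1 + i)) = (\<Sum>i\<le>w. y i) * (K + 1) + (\<Sum>i\<le>w. y i * i)"
      unfolding sum_distrib_right sum.distrib[symmetric] by (simp add: algebra_simps)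
    then have "(\<Sum>i\<le>w. y i * (K + 1 + i)) = D" using y *(2) by simp
    then have "(\<Sum>i<length ?A. x i * ?A ! i) = n"
      unfolding expand w using * y(1) by (simp add: x_def)
    then show "representable ?A n" unfolding representable_def by metis
  qed
qed

text \<open>The least \<open>s\<close> with \<open>D \<le> s * k\<close> works: for
  \<open>s = 1\<close> and \<open>s = 2\<close> the lower bound can fail only in a gap, and from
  \<open>s = 3\<close> on the intervals \<open>{s * (K + 1)..s * k}\<close> leave no integer
  uncovered.\<close>

lemma ex_summand_count:
  fixes D K k t :: nat
  assumes "K < k" "3 * K + 2 \<le> 2 * k" "D \<notin> {1..K}" "D \<notin> {k + 1..2 * K + 1}" "D \<le> t * k"
  shows "\<exists>s\<le>t. s * (K + 1) \<le> D \<and> D \<le> s * k"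
proof -
  define s where "s = (LEAST s. D \<le> s * k)"
  have le: "D \<le> s * k" unfolding s_def using assms(5) by (rule LeastI)
  have st: "s \<le> t" unfolding s_def using assms(5) by (rule Least_le)
  have "s * (K + 1) \<le> D"
  proof (cases "s < 3")
    case True
    then consider "s = 0" | "s = 1" | "s = 2" by linarith
    then show ?thesis
    proof cases
      case 2
      then have "D \<noteq> 0" using not_less_Least[of 0 "\<lambda>s. D \<le> s * k"] by (auto simp: s_def)
      then show ?thesis using 2 assms(3) by auto
    next
      case 3
      then have "\<not> D \<le> 1 * k" using not_less_Least[of 1 "\<lambda>s. D \<le> s * k"] by (auto simp: s_def)
      then show ?thesis using 3 assms(4) by auto
    qed simp
  next
    case False
    then obtain u where u: "s = u + 3" using le_Suc_ex[of 3 s] by (auto simp: add.commute)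
    \<comment> \<open>Minimality gives
      \<open>D > u * k + 2 * k \<ge> u * (K + 1) + 3 * K + 2\<close>; strictness supplies the
      missing 1.\<close>
    have "\<not> D \<le> (u + 2) * k"
      using not_less_Least[of "u + 2" "\<lambda>s. D \<le> s * k"] u by (auto simp: s_def)
    moreover have "u * (K + 1) \<le> u * k" using assms(1) by (intro mult_left_mono) auto
    ultimately show ?thesis using assms(2) u by (simp add: algebra_simps)
  qed
  with le st show ?thesis by blast
qed

lemma frobenius_number_arith:
  fixes a d K k :: nat
  assumes "a > 0" "d > 0" "coprime a d" "k \<le> 2 * K" "3 * K + 2 \<le> 2 * k" "2 * k \<le> a + K"
  shows "frobenius_number (a # map (\<lambda>i. a + i * d) [K + 1..<k + 1]) =
    (a + 2 * K) div k * a + (a + 2 * K + 1) * d"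
proof -
  define A where "A = a # map (\<lambda>i. a + i * d) [K + 1..<k + 1]"
  define M where "M = (a + 2 * K) div k"
  \<comment> \<open>One \<open>a\<close> short of using \<open>M + 1\<close> generators, the least
    number that can reach \<open>D = a + 2 * K + 1\<close>.\<close>
  define G where "G = M * a + (a + 2 * K + 1) * d"
  have kK: "K < k" using assms by linarith
  then have k0: "k > 0" by simp
  \<comment> \<open>Both gaps lie below \<open>a\<close>, so shifting a gap element by
    \<open>a\<close> leaves the gaps.\<close>
  have a_large: "2 * K + 1 < a" using assms by linarith
  have M_less: "M * k < a + 2 * K + 1" by (simp add: M_def le_imp_less_Suc)
  have M_ge: "a + 2 * K + 1 \<le> (M + 1) * k"
    using dividend_less_div_times[OF k0, of "a + 2 * K"] by (simp add: M_def)
  note rep = representable_arith_iff[OF kK, of a d, folded A_def]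
  have not_rep: "\<not> representable A G"
  proof
    assume "representable A G"
    then obtain m s D where *: "s \<le> m" "s * (K + 1) \<le> D" "D \<le> s * k" "G = m * a + D * d"
      unfolding rep by blast
    have "[D * d = (2 * K + 1) * d] (mod a)"
    proof -
      have "[D * d = m * a + D * d] (mod a)" by (simp add: cong_def)
      also have "m * a + D * d = (M + d) * a + (2 * K + 1) * d"
        using *(4) by (simp add: G_def algebra_simps)
      also have "[\<dots> = (2 * K + 1) * d] (mod a)" by (simp add: cong_def del: mult_Suc)
      finally show ?thesis .
    qed
    then have "[D = 2 * K + 1] (mod a)"
      using assms(3) by (metis cong_mult_rcancel_nat coprime_commute)
    then have D_mod: "D mod a = 2 * K + 1" using a_large by (simp add: cong_def)
    show False
    proof (cases "D < a")
      case True
      then have D: "D = 2 * K + 1" using D_mod by simp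
      \<comment> \<open>Two summands give at least \<open>2 * K + 2\<close>, one gives at most
        \<open>k \<le> 2 * K\<close>.\<close>
      then have "s < 2" using *(2) mult_le_mono1[of 2 s "K + 1"] by (cases "2 \<le> s") auto
      then have "s * k \<le> 1 * k" by (intro mult_le_mono1) simp
      then show False using *(3) D assms(4) by linarith
    next
      case False
      then have "1 \<le> D div a" using assms(1) by (simp add: div_greater_zero_iff Suc_le_eq)
      then have "a \<le> D div a * a" by simp
      \<comment> \<open>So \<open>D\<close> is at least the coefficient of \<open>d\<close> in
        \<open>G\<close>, which forces \<open>m \<le> M\<close>; but \<open>M\<close> summands stay
        below \<open>a + 2 * K + 1\<close>.\<close>
      then have D: "a + 2 * K + 1 \<le> D" using D_mod div_mult_mod_eq[of D a] by linarith
      then have "(a + 2 * K + 1) * d \<le> D * d" by (rule mult_le_mono1)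
      then have "m * a \<le> M * a" using *(4) unfolding G_def by linarith
      then have "s \<le> M" using *(1) assms(1) by simp
      then have "s * k \<le> M * k" by (rule mult_le_mono1)
      then show False using D *(3) M_less by linarith
    qed
  qed
  have rep_above: "representable A N" if N: "N > G" for N
  proof -
    obtain u where u: "[d * u = 1] (mod a)"
      using cong_solve_coprime_nat[of d a] assms(3) by (auto simp: coprime_commute)
    \<comment> \<open>As \<open>u\<close> inverts \<open>d\<close> modulo \<open>a\<close>, this is
      the residue that \<open>D\<close> must have.\<close>
    define D0 where "D0 = (u * N) mod a"
    have D0_less: "D0 < a" using assms(1) by (simp add: D0_def)
    have "[D0 * d = u * N * d] (mod a)"
      by (intro cong_scalar_right) (simp add: D0_def cong_def)
    also have "u * N * d = (d * u) * N" by (simp add: ac_simps)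
    also have "[(d * u) * N = 1 * N] (mod a)" using u by (rule cong_scalar_right)
    finally have D0_cong: "[D0 * d = N] (mod a)" by simp
    define D where "D = (if D0 \<in> {1..K} \<or> D0 \<in> {k + 1..2 * K + 1} then D0 + a else D0)"
    have D_le: "D \<le> a + 2 * K + 1" using D0_less kK by (auto simp: D_def)
    have D_nongap: "D \<notin> {1..K}" "D \<notin> {k + 1..2 * K + 1}"
      using a_large kK by (auto simp: D_def)
    have "[D * d = D0 * d] (mod a)" by (auto simp: D_def cong_def add_mult_distrib)
    with D0_cong have D_cong: "[D * d = N] (mod a)" using cong_trans by blast
    have "D \<le> (M + 1) * k" using D_le M_ge by linarith
    from ex_summand_count[OF kK assms(5) D_nongap this]
    obtain s where s: "s \<le> M + 1" "s * (K + 1) \<le> D" "D \<le> s * k" by blast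
    have "D * d \<le> (a + 2 * K + 1) * d" using D_le by (rule mult_le_mono1)
    then have gt: "M * a + D * d < N" using N by (simp add: G_def)
    then have "a dvd N - D * d"
      using D_cong by (simp add: cong_altdef_nat cong_sym_eq)
    then obtain m where m: "N - D * d = m * a" by (metis dvd_def mult.commute)
    with gt have N_eq: "N = m * a + D * d" by linarith
    \<comment> \<open>Exceeding \<open>G\<close> strictly makes room for the \<open>M + 1\<close>
      summands that \<open>D\<close> may need.\<close>
    with gt have "M < m" by simp
    with s(1) have "s \<le> m" by linarith
    with s N_eq show ?thesis unfolding rep by blast
  qed
  have "(GREATEST n. n > 0 \<and> \<not> representable A n) = G"
  proof (rule Greatest_equality)
    show "G > 0 \<and> \<not> representable A G" using not_rep assms(2) by (simp add: G_def)
  qed (use rep_above in \<open>auto simp: not_less[symmetric]\<close>)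
  then show ?thesis by (simp add: frobenius_number_def A_def G_def M_def)
qed

theorem theorem5:
  fixes a d K k :: nat and r :: int
  assumes "a \<ge> 2" and "d > 0" and "gcd a d = 1"
    and "K > 0" and "k > 0"
    and "(real k - 1) / 2 < real K" and "real K \<le> (2 * real k - 2) / 3"
    and "r = int a + int K - \<lfloor>(real a + real K) / real k\<rfloor> * int k"
    and "\<lfloor>(real a + real K) / real k\<rfloor> \<ge> 2"
  shows "(0 \<le> r \<and> r \<le> int k - int K - 1 \<longrightarrow>
            real (frobenius_number (a # map (\<lambda>i. a + i * d) [K + 1..<k + 1])) =
              real a * (real a + real K - real_of_int r) / real k
                + (real a + 2 * real K + 1) * real d) \<and>
         (int k - int K \<le> r \<and> r < int k \<longrightarrow>
            real (frobenius_number (a # map (\<lambda>i. a + i * d) [K + 1..<k + 1])) =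
              real a * (real a + real K - real_of_int r + real k) / real k
                + (real a + 2 * real K + 1) * real d)"
proof -
  have "real k < real (2 * K + 1)" "real (3 * K + 2) \<le> real (2 * k)"
    using assms(6,7) by (simp_all add: field_simps)
  \<comment> \<open>Integrality turns the strict bound \<open>k < 2 * K + 1\<close> into
    \<open>k \<le> 2 * K\<close>.\<close>
  then have ineqs: "k \<le> 2 * K" "3 * K + 2 \<le> 2 * k" by linarith+
  define q where "q = (a + K) div k"
  define t where "t = (a + K) mod k"
  have q: "\<lfloor>(real a + real K) / real k\<rfloor> = int q"
    using floor_divide_of_nat_eq[of "a + K" k, where ?'a = real] by (simp add: q_def)
  have aK: "a + K = q * k + t" by (simp add: q_def t_def)
  have t: "t < k" using assms(5) by (simp add: t_def)
  have "int a + int K = int q * int k + int t" using arg_cong[OF aK, of int] by simp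
  then have r: "r = int t" using assms(8) q by simp
  have "2 \<le> q" using assms(9) q by simp
  then have "2 * k \<le> a + K" using mult_le_mono1[of 2 q k] aK by linarith
  then have F: "frobenius_number (a # map (\<lambda>i. a + i * d) [K + 1..<k + 1]) =
      (a + 2 * K) div k * a + (a + 2 * K + 1) * d"
    using assms ineqs by (intro frobenius_number_arith) (auto simp: coprime_iff_gcd_eq_1)
  \<comment> \<open>The two cases of the formula record whether adding \<open>K\<close> to the
    remainder \<open>t\<close> passes \<open>k\<close>; as \<open>t + K < 2 * k\<close>, the
    quotient rises by at most 1.\<close>
  have aK': "a + 2 * K = t + K + q * k" using aK by simp
  have aKr: "real a + real K - real t = real q * real k"
    using arg_cong[OF aK, of real] by simp
  have div_small: "(a + 2 * K) div k = q" if "t + K < k"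
    unfolding aK' using that by simp
  have div_large: "(a + 2 * K) div k = q + 1" if "k \<le> t + K"
  proof -
    have "t + K < 2 * k" using t ineqs by linarith
    with that show ?thesis unfolding aK' by (intro div_nat_eqI) (auto simp: algebra_simps)
  qed
  have small: "real a * (real a + real K - real t) / real k = real a * real q"
    using assms(5) by (simp add: aKr)
  have "real a + real K - real t + real k = (real q + 1) * real k"
    using aKr by (simp add: algebra_simps)
  then have large: "real a * (real a + real K - real t + real k) / real k = real a * (real q + 1)"
    using assms(5) by simp
  show ?thesis
  proof (intro conjI impI)
    assume "0 \<le> r \<and> r \<le> int k - int K - 1"
    then have "t + K < k" using r by linarith
    then show "real (frobenius_number (a # map (\<lambda>i. a + i * d) [K + 1..<k + 1])) =
        real a * (real a + real K - real_of_int r) / real k + (real a + 2 * real K + 1) * real d"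
      unfolding F r of_int_of_nat_eq small div_small[OF \<open>t + K < k\<close>] by (simp add: algebra_simps)
  next
    assume "int k - int K \<le> r \<and> r < int k"
    then have "k \<le> t + K" using r by linarith
    then show "real (frobenius_number (a # map (\<lambda>i. a + i * d) [K + 1..<k + 1])) =
        real a * (real a + real K - real_of_int r + real k) / real k
          + (real a + 2 * real K + 1) * real d"
      unfolding F r of_int_of_nat_eq large div_large[OF \<open>k \<le> t + K\<close>] by (simp add: algebra_simps)
  qed
qed

end
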